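(* Let $X$ and $Y$ be nonempty sets and let $f: X\times Y\to\mathbb{R}$ be a function. Suppose that $f(\cdot,y)$ is bounded on $X$ for every $y\in Y$, that $f$ is $t$-convexlike on $X$ for some $t\in(0,1)$, and that $f$ is supinf-concave on $Y$. Then the following assertions are equivalent. (a) For every net $(x_\alpha)_\alpha\subset X$, $$\inf_{x\in X}\sup_{y\in Y} f(x,y)\leq \sup_{y\in Y}\limsup_\alpha f(x_\alpha,y).$$ (b) The minimax equality holds: $$\inf_{x\in X}\sup_{y\in Y} f(x,y)=\sup_{y\in Y}\inf_{x\in X} f(x,y).$$
   Context: Infima and suprema are taken in the extended reals. $f:X\times Y\to\mathbb{R}$ is $t$-convexlike on $X$ if for all $x_1,x_2\in X$ there exists $x_3\in X$ such that $f(x_3,y)\leq t f(x_1,y)+(1-t)f(x_2,y)$ for all $y\in Y$. For $n\ge 1$, $\Delta_n=\{(\lambda_1,\dots,\lambda_n)\in\mathbb{R}_+^n:\sum_{i=1}^n\lambda_i=1\}$. $f$ is supinf-concave on $Y$ if $$\sup_{y\in Y}\inf_{x\in X} f(x,y)=\sup_{n\geq 1,\ y_1,\dots,y_n\in Y,\ (\lambda_1,\dots,\lambda_n)\in\Delta_n}\ \inf_{x\in X}\sum_{i=1}^n\lambda_i f(x,y_i).$$ *)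

theory Defs
  imports "HOL-Analysis.Analysis"
begin

definition convexlike_on :: "real \<Rightarrow> 'a set \<Rightarrow> 'b set \<Rightarrow> ('a \<Rightarrow> 'b \<Rightarrow> real) \<Rightarrow> bool" where
  "convexlike_on t X Y f \<longleftrightarrow>
     (\<forall>x1\<in>X. \<forall>x2\<in>X. \<exists>x3\<in>X. \<forall>y\<in>Y. f x3 y \<le> t * f x1 y + (1 - t) * f x2 y)"

text \<open>Only the values of \<open>w\<close> on \<open>{1..n}\<close> matter.\<close>

definition weights :: "nat \<Rightarrow> (nat \<Rightarrow> real) set" where
  "weights n = {w. (\<forall>i\<in>{1..n}. 0 \<le> w i) \<and> (\<Sum>i=1..n. w i) = 1}"

definition supinf_concave_on :: "'a set \<Rightarrow> 'b set \<Rightarrow> ('a \<Rightarrow> 'b \<Rightarrow> real) \<Rightarrow> bool" where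
  "supinf_concave_on X Y f \<longleftrightarrow>
     (SUP y\<in>Y. INF x\<in>X. ereal (f x y)) =
     (SUP (n, ys, w)\<in>{(n, ys, w). 1 \<le> n \<and> ys \<in> {1..n} \<rightarrow> Y \<and> w \<in> weights n}.
        INF x\<in>X. ereal (\<Sum>i=1..n. w i * f x (ys i)))"

text \<open>Antisymmetry is not required of a directed set.\<close>

definition directed_set :: "'i set \<Rightarrow> ('i \<Rightarrow> 'i \<Rightarrow> bool) \<Rightarrow> bool" where
  "directed_set D le \<longleftrightarrow> D \<noteq> {} \<and> reflp_on D le \<and> transp_on D le \<and>
     (\<forall>i\<in>D. \<forall>j\<in>D. \<exists>k\<in>D. le i k \<and> le j k)"

lemma directed_setD:
  assumes "directed_set D le"
  shows "D \<noteq> {}"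
    and "i \<in> D \<Longrightarrow> le i i"
    and "i \<in> D \<Longrightarrow> j \<in> D \<Longrightarrow> k \<in> D \<Longrightarrow> le i j \<Longrightarrow> le j k \<Longrightarrow> le i k"
    and "i \<in> D \<Longrightarrow> j \<in> D \<Longrightarrow> \<exists>k\<in>D. le i k \<and> le j k"
  using assms unfolding directed_set_def by (simp_all add: reflp_on_def transp_onD[of D le i j k])

definition tail_filter :: "'i set \<Rightarrow> ('i \<Rightarrow> 'i \<Rightarrow> bool) \<Rightarrow> 'i filter" where
  "tail_filter D le = (INF i\<in>D. principal {j\<in>D. le i j})"

lemma eventually_tail_filter:
  assumes "directed_set D le"
  shows "eventually P (tail_filter D le) \<longleftrightarrow> (\<exists>i\<in>D. \<forall>j\<in>D. le i j \<longrightarrow> P j)"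
proof -
  have "\<exists>k\<in>D. principal {j\<in>D. le k j} \<le>
          inf (principal {j\<in>D. le a j}) (principal {j\<in>D. le b j})"
    if "a \<in> D" "b \<in> D" for a b
  proof -
    obtain k where k: "k \<in> D" "le a k" "le b k"
      using directed_setD(4)[OF assms \<open>a \<in> D\<close> \<open>b \<in> D\<close>] by auto
    have "{j\<in>D. le k j} \<subseteq> {j\<in>D. le a j} \<inter> {j\<in>D. le b j}"
      using directed_setD(3)[OF assms \<open>a \<in> D\<close> k(1)] directed_setD(3)[OF assms \<open>b \<in> D\<close> k(1)] k(2,3)
      by auto
    then show ?thesis using k(1) by auto
  qed
  then have "eventually P (tail_filter D le) \<longleftrightarrow>
      (\<exists>i\<in>D. eventually P (principal {j\<in>D. le i j}))"
    unfolding tail_filter_def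
    by (intro eventually_INF_base directed_setD(1)[OF assms]) auto
  then show ?thesis by (auto simp: eventually_principal)
qed

text \<open>The library's \<open>Limsup\<close> along the tail filter is the usual upper limit of a net.\<close>

lemma Limsup_tail_filter:
  fixes g :: "'i \<Rightarrow> ereal"
  assumes "directed_set D le"
  shows "Limsup (tail_filter D le) g = (INF i\<in>D. SUP j\<in>{j\<in>D. le i j}. g j)"
proof (rule antisym)
  show "Limsup (tail_filter D le) g \<le> (INF i\<in>D. SUP j\<in>{j\<in>D. le i j}. g j)"
  proof (rule INF_greatest)
    fix i assume "i \<in> D"
    then show "Limsup (tail_filter D le) g \<le> (SUP j\<in>{j\<in>D. le i j}. g j)"
      by (intro Limsup_bounded)
         (auto simp: eventually_tail_filter[OF assms] intro!: bexI[of _ i] SUP_upper)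
  qed
  show "(INF i\<in>D. SUP j\<in>{j\<in>D. le i j}. g j) \<le> Limsup (tail_filter D le) g"
    unfolding Limsup_def
  proof (rule INF_greatest)
    fix P assume "P \<in> {P. eventually P (tail_filter D le)}"
    then obtain i where "i \<in> D" "\<forall>j\<in>D. le i j \<longrightarrow> P j"
      by (auto simp: eventually_tail_filter[OF assms])
    then show "(INF i\<in>D. SUP j\<in>{j\<in>D. le i j}. g j) \<le> Sup (g ` Collect P)"
      by (intro INF_lower2[of i] SUP_subset_mono) auto
  qed
qed

text \<open>
  The condition on all nets in \<open>X\<close> whose index set is carried by a subset of the type \<open>'i\<close>.
  Types cannot be quantified inside a formula, hence the type argument. The index type
  \<open>'a \<times> 'a set\<close>, which carries the canonical net of every proper filter on \<open>'a\<close>, is as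
  general as any other: see \<open>net_condition_any_index\<close> below.
\<close>

definition net_condition ::
  "'i itself \<Rightarrow> 'a set \<Rightarrow> 'b set \<Rightarrow> ('a \<Rightarrow> 'b \<Rightarrow> real) \<Rightarrow> bool" where
  "net_condition _ X Y f \<longleftrightarrow>
     (\<forall>(D :: 'i set) le x. directed_set D le \<and> x \<in> D \<rightarrow> X \<longrightarrow>
        (INF x\<in>X. SUP y\<in>Y. ereal (f x y)) \<le>
        (SUP y\<in>Y. Limsup (tail_filter D le) (\<lambda>\<alpha>. ereal (f (x \<alpha>) y))))"

lemma net_condition_any_index:
  fixes X :: "'a set" and Y :: "'b set"
  assumes canonical: "net_condition TYPE('a \<times> 'a set) X Y f"
  shows "net_condition TYPE('i) X Y f"
  unfolding net_condition_def
proof (intro allI impI, elim conjE)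
  fix D :: "'i set" and le x
  assume dir: "directed_set D le" and x: "x \<in> D \<rightarrow> X"
  define T where "T i = x ` {j\<in>D. le i j}" for i
  define E where "E = {(p, A). \<exists>i\<in>D. A = T i \<and> p \<in> A}"
  define sup_le where "sup_le = (\<lambda>(p::'a, A::'a set) (q::'a, B::'a set). B \<subseteq> A)"
  have self: "x i \<in> T i" if "i \<in> D" for i
    using directed_setD(2)[OF dir that] that unfolding T_def by auto
  have T_mono: "T k \<subseteq> T i" if "i \<in> D" "k \<in> D" "le i k" for i k
    using directed_setD(3)[OF dir that(1,2)] that(3) unfolding T_def by auto
  have dirE: "directed_set E sup_le"
    unfolding directed_set_def
  proof (intro conjI ballI)
    obtain i where "i \<in> D" using directed_setD(1)[OF dir] by auto
    then have "(x i, T i) \<in> E" using self unfolding E_def by blast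
    then show "E \<noteq> {}" by blast
    show "reflp_on E sup_le" "transp_on E sup_le"
      by (auto simp: reflp_on_def transp_on_def sup_le_def)
    fix u v assume "u \<in> E" "v \<in> E"
    then obtain p i q j where uv: "u = (p, T i)" "v = (q, T j)" "i \<in> D" "j \<in> D"
      by (auto simp: E_def)
    obtain k where k: "k \<in> D" "le i k" "le j k"
      using directed_setD(4)[OF dir uv(3,4)] by auto
    then have "(x k, T k) \<in> E" using self unfolding E_def by blast
    then show "\<exists>w\<in>E. sup_le u w \<and> sup_le v w"
      using uv T_mono[OF uv(3) k(1,2)] T_mono[OF uv(4) k(1,3)]
      by (intro bexI[of _ "(x k, T k)"]) (auto simp: sup_le_def)
  qed
  have fstE: "fst \<in> E \<rightarrow> X" using x by (auto simp: E_def T_def)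
  have "Limsup (tail_filter E sup_le) (\<lambda>\<alpha>. ereal (f (fst \<alpha>) y)) \<le>
        Limsup (tail_filter D le) (\<lambda>\<alpha>. ereal (f (x \<alpha>) y))" for y
    unfolding Limsup_tail_filter[OF dir] Limsup_tail_filter[OF dirE]
  proof (rule INF_greatest)
    fix i assume i: "i \<in> D"
    have "(SUP w\<in>{w\<in>E. sup_le (x i, T i) w}. ereal (f (fst w) y)) \<le>
          (SUP j\<in>{j\<in>D. le i j}. ereal (f (x j) y))"
    proof (rule SUP_least)
      fix w assume "w \<in> {w\<in>E. sup_le (x i, T i) w}"
      then have "fst w \<in> T i" by (auto simp: E_def sup_le_def)
      then obtain j where "j \<in> D" "le i j" "fst w = x j" by (auto simp: T_def)
      then show "ereal (f (fst w) y) \<le> (SUP j\<in>{j\<in>D. le i j}. ereal (f (x j) y))"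
        by (intro SUP_upper2[of j]) auto
    qed
    moreover have "(x i, T i) \<in> E" using i self unfolding E_def by blast
    ultimately show "(INF u\<in>E. SUP w\<in>{w\<in>E. sup_le u w}. ereal (f (fst w) y)) \<le>
        (SUP j\<in>{j\<in>D. le i j}. ereal (f (x j) y))"
      by (intro INF_lower2[of "(x i, T i)"])
  qed
  then have "(SUP y\<in>Y. Limsup (tail_filter E sup_le) (\<lambda>\<alpha>. ereal (f (fst \<alpha>) y))) \<le>
      (SUP y\<in>Y. Limsup (tail_filter D le) (\<lambda>\<alpha>. ereal (f (x \<alpha>) y)))"
    by (intro SUP_mono) auto
  moreover have "(INF x\<in>X. SUP y\<in>Y. ereal (f x y)) \<le>
      (SUP y\<in>Y. Limsup (tail_filter E sup_le) (\<lambda>\<alpha>. ereal (f (fst \<alpha>) y)))"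
    using canonical dirE fstE unfolding net_condition_def by blast
  ultimately show "(INF x\<in>X. SUP y\<in>Y. ereal (f x y)) \<le>
      (SUP y\<in>Y. Limsup (tail_filter D le) (\<lambda>\<alpha>. ereal (f (x \<alpha>) y)))"
    by (rule order_trans[rotated])
qed

definition minimax_equality :: "'a set \<Rightarrow> 'b set \<Rightarrow> ('a \<Rightarrow> 'b \<Rightarrow> real) \<Rightarrow> bool" where
  "minimax_equality X Y f \<longleftrightarrow>
     (INF x\<in>X. SUP y\<in>Y. ereal (f x y)) = (SUP y\<in>Y. INF x\<in>X. ereal (f x y))"

end

(* For (a) \<Longrightarrow> (b), let v be the right-hand side of (b). For finite F in Y and c > v some x in X
   has f x y < c on all of F. Otherwise max {f x y | y in F} \<ge> c on X, and a convex combination of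
   the f(_, y) is \<ge> c on X, which contradicts supinf-concavity. That combination is built by induction
   on F, removing one y at a time: convexlikeness passes to the sublevel set {x. f x y < c}, so only
   the case of two functions is left, a separation in the plane. The points x so obtained, indexed by
   (F, c), form a net with upper limits \<le> v. *)
theory Submission
  imports Defs
begin

section \<open>Convexity from a single ratio, and separation in the plane\<close>

text \<open>A point of a segment missing from \<open>K\<close> would lie in a gap whose two ends
  belong to \<open>K\<close>, as \<open>K\<close> is closed; the combination of these ends with
  ratio \<open>t\<close> would be a point of \<open>K\<close> inside the gap.\<close>

lemma closed_imp_convex_if_convex_combination:
  fixes K :: "'a :: real_normed_vector set"
  assumes "closed K" and t: "0 < t" "t < 1"
    and comb: "\<And>u v. u \<in> K \<Longrightarrow> v \<in> K \<Longrightarrow> t *\<^sub>R u + (1 - t) *\<^sub>R v \<in> K"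
  shows "convex K"
  unfolding convex_alt
proof (intro ballI allI impI, elim conjE)
  fix x y and u :: real assume xy: "x \<in> K" "y \<in> K" and u: "0 \<le> u" "u \<le> 1"
  define g where "g s = (1 - s) *\<^sub>R x + s *\<^sub>R y" for s :: real
  have closed_vimage: "closed (g -` K)"
    unfolding g_def by (intro closed_vimage \<open>closed K\<close> continuous_intros)
  have "compact (g -` K \<inter> {0..u})" "compact (g -` K \<inter> {u..1})"
    using closed_vimage by (simp_all add: closed_Int_compact)
  moreover have "0 \<in> g -` K \<inter> {0..u}" "1 \<in> g -` K \<inter> {u..1}"
    using xy u by (auto simp: g_def)
  \<comment> \<open>\<open>a\<close> is the last parameter up to \<open>u\<close>, and
    \<open>b\<close> the first from \<open>u\<close> on, at which the segment meets
    \<open>K\<close>.\<close>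
  ultimately obtain a b
    where a: "g a \<in> K" "0 \<le> a" "a \<le> u" "\<And>s. g s \<in> K \<Longrightarrow> 0 \<le> s \<Longrightarrow> s \<le> u \<Longrightarrow> s \<le> a"
      and b: "g b \<in> K" "u \<le> b" "b \<le> 1" "\<And>s. g s \<in> K \<Longrightarrow> u \<le> s \<Longrightarrow> s \<le> 1 \<Longrightarrow> b \<le> s"
    using compact_attains_sup[of "g -` K \<inter> {0..u}"] compact_attains_inf[of "g -` K \<inter> {u..1}"]
    by (metis (no_types, lifting) Int_iff atLeastAtMost_iff emptyE vimage_eq)
  define m where "m = t * a + (1 - t) * b"
  have "g m = t *\<^sub>R g a + (1 - t) *\<^sub>R g b"
    by (simp add: g_def m_def algebra_simps)
  then have gm: "g m \<in> K" using comb a(1) b(1) by simp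
  have m: "m - a = (1 - t) * (b - a)" "b - m = t * (b - a)"
    by (simp_all add: m_def algebra_simps)
  have "a = b"
  proof (rule ccontr)
    assume "a \<noteq> b"
    then have "0 < m - a" "0 < b - m" using a(3) b(2) t unfolding m by simp_all
    then show False using a(2,3) a(4)[OF gm] b(2,3) b(4)[OF gm] by linarith
  qed
  then show "(1 - u) *\<^sub>R x + u *\<^sub>R y \<in> K" using a(1,3) b(2) by (simp add: g_def)
qed

lemma convexlike_pair_combination_ge:
  fixes g h :: "'a \<Rightarrow> real"
  assumes t: "0 < t" "t < 1"
    and conv: "\<And>x1 x2. x1 \<in> X \<Longrightarrow> x2 \<in> X \<Longrightarrow>
      \<exists>x3\<in>X. g x3 \<le> t * g x1 + (1 - t) * g x2 \<and> h x3 \<le> t * h x1 + (1 - t) * h x2"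
    and ge: "\<And>x. x \<in> X \<Longrightarrow> c \<le> g x \<or> c \<le> h x"
  shows "\<exists>l. 0 \<le> l \<and> l \<le> 1 \<and> (\<forall>x\<in>X. c \<le> l * g x + (1 - l) * h x)"
\<comment> \<open>Empty \<open>X\<close> does occur: in the later induction the sublevel set that
  replaces \<open>X\<close> may be empty.\<close>
proof (cases "X = {}")
  case False
  \<comment> \<open>The image of \<open>(g, h)\<close> enlarged upwards, so that the inequalities in
    \<open>conv\<close> become membership and a separating normal must be nonnegative. It is to be
    separated from the open quadrant below \<open>(c, c)\<close>.\<close>
  define C where "C = {z. \<exists>x\<in>X. g x \<le> fst z \<and> h x \<le> snd z}"
  define S where "S = {..<c} \<times> {..<c}"
  have C_comb: "t *\<^sub>R u + (1 - t) *\<^sub>R v \<in> C" if uv: "u \<in> C" "v \<in> C" for u v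
  proof -
    obtain x1 x2 where x: "x1 \<in> X" "g x1 \<le> fst u" "h x1 \<le> snd u"
        "x2 \<in> X" "g x2 \<le> fst v" "h x2 \<le> snd v"
      using uv unfolding C_def by blast
    obtain x3 where "x3 \<in> X" "g x3 \<le> t * g x1 + (1 - t) * g x2"
        "h x3 \<le> t * h x1 + (1 - t) * h x2"
      using conv x by blast
    moreover have "t * g x1 + (1 - t) * g x2 \<le> t * fst u + (1 - t) * fst v"
      "t * h x1 + (1 - t) * h x2 \<le> t * snd u + (1 - t) * snd v"
      using x t by (auto intro!: add_mono mult_left_mono)
    ultimately show ?thesis unfolding C_def by force
  qed
  have "t *\<^sub>R u + (1 - t) *\<^sub>R v \<in> closure C" if "u \<in> closure C" "v \<in> closure C" for u v
  proof -
    from that obtain U V where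
      "\<And>n. U n \<in> C" "U \<longlonglongrightarrow> u" "\<And>n. V n \<in> C" "V \<longlonglongrightarrow> v"
      unfolding closure_sequential by blast
    then show ?thesis
      unfolding closure_sequential
      by (intro exI[of _ "\<lambda>n. t *\<^sub>R U n + (1 - t) *\<^sub>R V n"]) (auto intro!: C_comb tendsto_intros)
  qed
  then have "convex (closure C)"
    by (intro closed_imp_convex_if_convex_combination[OF closed_closure t])
  moreover have "convex S" unfolding S_def by (intro convex_Times) simp_all
  moreover have "S \<inter> closure C = {}"
  proof -
    \<comment> \<open>Only the closure of \<open>C\<close> is known to be convex; openness of
      \<open>S\<close> carries disjointness over to it.\<close>
    have "open S" unfolding S_def by (intro open_Times) simp_all
    moreover have "S \<inter> C = {}" using ge by (force simp: S_def C_def)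
    ultimately show ?thesis by (simp add: open_Int_closure_eq_empty)
  qed
  moreover have "(c - 1, c - 1) \<in> S" by (simp add: S_def)
  then have "S \<noteq> {}" by blast
  moreover obtain x0 where "x0 \<in> X" using False by blast
  then have "(g x0, h x0) \<in> C" by (auto simp: C_def)
  then have "closure C \<noteq> {}" by auto
  ultimately obtain a b where "a \<noteq> 0"
      and S_le: "\<forall>z\<in>S. inner a z \<le> b" and C_ge: "\<forall>z\<in>closure C. b \<le> inner a z"
    using separating_hyperplane_sets[of S "closure C"] by metis
  obtain p q where a: "a = (p, q)" by fastforce
  have le: "p * r + q * s \<le> b" if "r < c" "s < c" for r s
    using S_le that by (auto simp: a S_def)
  have ge: "b \<le> p * r + q * s" if "x \<in> X" "g x \<le> r" "h x \<le> s" for x r s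
  proof -
    have "(r, s) \<in> C" using that by (auto simp: C_def)
    then have "(r, s) \<in> closure C" using closure_subset by blast
    then show ?thesis using C_ge by (auto simp: a)
  qed
  have p: "0 \<le> p"
  proof (rule ccontr)
    assume "\<not> 0 \<le> p"
    \<comment> \<open>Moving right from \<open>(g x0, h x0)\<close> stays in \<open>C\<close>;
      \<open>r\<close> is chosen so that the functional takes the value \<open>b - 1\<close>
      there.\<close>
    define r where "r = g x0 + (p * g x0 + q * h x0 - b + 1) / (- p)"
    have "b \<le> p * g x0 + q * h x0" using ge \<open>x0 \<in> X\<close> by simp
    then have "g x0 \<le> r" using \<open>\<not> 0 \<le> p\<close> by (simp add: r_def divide_nonneg_neg)
    then have "b \<le> p * r + q * h x0" using ge \<open>x0 \<in> X\<close> by simp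
    moreover have "p * r = b - q * h x0 - 1"
      using \<open>\<not> 0 \<le> p\<close> by (simp add: r_def field_simps)
    ultimately show False by simp
  qed
  have q: "0 \<le> q"
  proof (rule ccontr)
    assume "\<not> 0 \<le> q"
    define r where "r = h x0 + (p * g x0 + q * h x0 - b + 1) / (- q)"
    have "b \<le> p * g x0 + q * h x0" using ge \<open>x0 \<in> X\<close> by simp
    then have "h x0 \<le> r" using \<open>\<not> 0 \<le> q\<close> by (simp add: r_def divide_nonneg_neg)
    then have "b \<le> p * g x0 + q * r" using ge \<open>x0 \<in> X\<close> by simp
    moreover have "q * r = b - p * g x0 - 1"
      using \<open>\<not> 0 \<le> q\<close> by (simp add: r_def field_simps)
    ultimately show False by simp
  qed
  have pq: "0 < p + q" using p q \<open>a \<noteq> 0\<close> by (auto simp: a zero_prod_def)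
  \<comment> \<open>Diagonal points \<open>(r, r)\<close> of the quadrant, with \<open>r\<close>
    tending to \<open>c\<close>.\<close>
  have "c \<le> b / (p + q)"
  proof (rule dense_le)
    fix r assume "r < c"
    then show "r \<le> b / (p + q)" using le[of r r] pq by (simp add: field_simps)
  qed
  have "c \<le> p / (p + q) * g x + (1 - p / (p + q)) * h x" if "x \<in> X" for x
  proof -
    have "c \<le> (p * g x + q * h x) / (p + q)"
      using \<open>c \<le> b / (p + q)\<close> divide_right_mono[OF ge[OF that order_refl order_refl], of "p + q"] pq
      by linarith
    moreover have "1 - p / (p + q) = q / (p + q)" using pq by (simp add: field_simps)
    ultimately show ?thesis by (simp add: add_divide_distrib)
  qed
  then show ?thesis using p q pq by (intro exI[of _ "p / (p + q)"]) simp
qed (auto intro: exI[of _ 0])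

section \<open>Finite families of functions\<close>

lemma convexlike_combination_ge:
  assumes "finite F" "F \<noteq> {}" and t: "0 < t" "t < 1"
    and "convexlike_on t X F f"
    and "\<And>x. x \<in> X \<Longrightarrow> \<exists>y\<in>F. c \<le> f x y"
  shows "\<exists>w. (\<forall>y\<in>F. 0 \<le> w y) \<and> sum w F = 1 \<and> (\<forall>x\<in>X. c \<le> (\<Sum>y\<in>F. w y * f x y))"
  using assms(1,2,5,6)
proof (induction F arbitrary: X rule: finite_ne_induct)
  case (singleton z)
  then show ?case by (intro exI[of _ "\<lambda>_. 1"]) auto
next
  case (insert z F)
  define X' where "X' = {x\<in>X. f x z < c}"
  have "convexlike_on t X' F f"
    unfolding convexlike_on_def
  proof (intro ballI)
    fix x1 x2 assume x: "x1 \<in> X'" "x2 \<in> X'"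
    then obtain x3 where x3: "x3 \<in> X" "\<forall>y\<in>insert z F. f x3 y \<le> t * f x1 y + (1 - t) * f x2 y"
      using insert.prems(1) unfolding convexlike_on_def X'_def by blast
    \<comment> \<open>Strictness keeps \<open>x3\<close> inside the sublevel set
      \<open>X'\<close>.\<close>
    have "t * f x1 z + (1 - t) * f x2 z < c"
      using x t by (intro convex_bound_lt) (auto simp: X'_def)
    then show "\<exists>x3\<in>X'. \<forall>y\<in>F. f x3 y \<le> t * f x1 y + (1 - t) * f x2 y"
      using x3 by (intro bexI[of _ x3]) (auto simp: X'_def)
  qed
  moreover have "\<exists>y\<in>F. c \<le> f x y" if "x \<in> X'" for x
    using insert.prems(2)[of x] that by (auto simp: X'_def)
  ultimately obtain w where w: "\<And>y. y \<in> F \<Longrightarrow> 0 \<le> w y" "sum w F = 1"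
      and w_ge: "\<And>x. x \<in> X' \<Longrightarrow> c \<le> (\<Sum>y\<in>F. w y * f x y)"
    using insert.IH[of X'] by blast
  \<comment> \<open>The weights found on \<open>X'\<close> merge \<open>F\<close> into one function.
    It is at least \<open>c\<close> wherever \<open>f _ z\<close> is below \<open>c\<close>, so the
    case of two functions applies to \<open>g\<close> and \<open>f _ z\<close> on all of
    \<open>X\<close>.\<close>
  define g where "g x = (\<Sum>y\<in>F. w y * f x y)" for x
  have "\<exists>x3\<in>X. g x3 \<le> t * g x1 + (1 - t) * g x2 \<and> f x3 z \<le> t * f x1 z + (1 - t) * f x2 z"
    if "x1 \<in> X" "x2 \<in> X" for x1 x2
  proof -
    obtain x3 where x3: "x3 \<in> X" "\<forall>y\<in>insert z F. f x3 y \<le> t * f x1 y + (1 - t) * f x2 y"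
      using insert.prems(1) \<open>x1 \<in> X\<close> \<open>x2 \<in> X\<close> unfolding convexlike_on_def by blast
    have "g x3 \<le> (\<Sum>y\<in>F. w y * (t * f x1 y + (1 - t) * f x2 y))"
      unfolding g_def using w(1) x3(2) by (intro sum_mono mult_left_mono) auto
    also have "\<dots> = t * g x1 + (1 - t) * g x2"
      unfolding g_def sum_distrib_left sum.distrib[symmetric]
      by (intro sum.cong) (auto simp: algebra_simps)
    finally show ?thesis using x3 by auto
  qed
  moreover have "c \<le> g x \<or> c \<le> f x z" if "x \<in> X" for x
    using w_ge[of x] that by (force simp: X'_def g_def)
  ultimately obtain l where l: "0 \<le> l" "l \<le> 1" "\<And>x. x \<in> X \<Longrightarrow> c \<le> l * g x + (1 - l) * f x z"
    using convexlike_pair_combination_ge[OF t, of X g "\<lambda>x. f x z" c] by metis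
  define w' where "w' y = (if y = z then 1 - l else l * w y)" for y
  have neq: "y \<noteq> z" if "y \<in> F" for y using that insert.hyps by auto
  have "sum w' F = l * sum w F"
    unfolding sum_distrib_left by (intro sum.cong) (auto simp: w'_def neq)
  then have "sum w' (insert z F) = 1" using insert.hyps w(2) by (simp add: w'_def)
  moreover have "(\<Sum>y\<in>F. w' y * f x y) = l * g x" for x
    unfolding g_def sum_distrib_left by (intro sum.cong) (auto simp: w'_def neq)
  then have "(\<Sum>y\<in>insert z F. w' y * f x y) = l * g x + (1 - l) * f x z" for x
    using insert.hyps by (simp add: w'_def)
  moreover have "\<forall>y\<in>insert z F. 0 \<le> w' y" using l(1,2) w(1) by (auto simp: w'_def)
  ultimately show ?case using l(3) by (intro exI[of _ w']) auto
qed

text \<open>Enumerating \<open>F\<close> by \<open>{1..card F}\<close> turns the weighted sum into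
  one of the competitors in the supremum over convex combinations, which supinf-concavity identifies
  with the supremum over \<open>Y\<close>.\<close>

lemma SUP_INF_convex_ge:
  assumes "finite F" "F \<noteq> {}" "F \<subseteq> Y" and w: "\<And>y. y \<in> F \<Longrightarrow> 0 \<le> w y" "sum w F = 1"
    and ge: "\<And>x. x \<in> X \<Longrightarrow> c \<le> (\<Sum>y\<in>F. w y * f x y)"
    and "supinf_concave_on X Y f"
  shows "ereal c \<le> (SUP y\<in>Y. INF x\<in>X. ereal (f x y))"
proof -
  obtain ys where ys: "bij_betw ys {1..card F} F"
    using ex_bij_betw_nat_finite_1[OF \<open>finite F\<close>] by blast
  have "ys \<in> {1..card F} \<rightarrow> F" using bij_betw_imp_funcset[OF ys] .
  moreover have "(\<Sum>i=1..card F. w (ys i)) = 1"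
    using sum.reindex_bij_betw[OF ys, of w] w(2) by simp
  moreover have "1 \<le> card F" using assms(1,2) by (simp add: Suc_le_eq card_gt_0_iff)
  ultimately have
    "(card F, ys, w \<circ> ys) \<in> {(n, ys, w). 1 \<le> n \<and> ys \<in> {1..n} \<rightarrow> Y \<and> w \<in> weights n}"
    using \<open>F \<subseteq> Y\<close> w(1) by (auto simp: weights_def Pi_iff)
  moreover have "ereal c \<le> (INF x\<in>X. ereal (\<Sum>i=1..card F. (w \<circ> ys) i * f x (ys i)))"
    using ge sum.reindex_bij_betw[OF ys, of "\<lambda>y. w y * f _ y"]
    by (intro INF_greatest) simp
  ultimately show ?thesis
    using assms(7) unfolding supinf_concave_on_def
    by (auto intro: SUP_upper2[of "(card F, ys, w \<circ> ys)"])
qed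

lemma ex_below_on_finite:
  assumes "X \<noteq> {}" and t: "0 < t" "t < 1" and conv: "convexlike_on t X Y f"
    and "supinf_concave_on X Y f" and "finite F" "F \<subseteq> Y"
    and c: "(SUP y\<in>Y. INF x\<in>X. ereal (f x y)) < ereal c"
  shows "\<exists>x\<in>X. \<forall>y\<in>F. f x y < c"
proof (rule ccontr)
  assume "\<not> ?thesis"
  then have ge: "\<And>x. x \<in> X \<Longrightarrow> \<exists>y\<in>F. c \<le> f x y" by (meson not_less)
  \<comment> \<open>Any point of \<open>X\<close> would need a witness in \<open>F\<close>.\<close>
  then have "F \<noteq> {}" using \<open>X \<noteq> {}\<close> by blast
  moreover have "convexlike_on t X F f"
    using conv \<open>F \<subseteq> Y\<close> unfolding convexlike_on_def by (meson subsetD)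
  ultimately obtain w where "\<forall>y\<in>F. 0 \<le> w y" "sum w F = 1"
      "\<forall>x\<in>X. c \<le> (\<Sum>y\<in>F. w y * f x y)"
    using convexlike_combination_ge[OF \<open>finite F\<close> _ t, of X f c] ge by blast
  then show False
    using SUP_INF_convex_ge[of F Y w X c f] assms \<open>F \<noteq> {}\<close> by (simp add: leD)
qed

section \<open>Nets and the minimax equality\<close>

text \<open>Each tail of a net contains its own starting index, so every upper limit along a net in
  \<open>X\<close> is at least the infimum over \<open>X\<close>.\<close>

lemma net_condition_if_minimax_equality:
  fixes X :: "'a set" and Y :: "'b set"
  assumes "minimax_equality X Y f"
  shows "net_condition TYPE('i) X Y f"
  unfolding net_condition_def
proof (intro allI impI, elim conjE)
  fix D :: "'i set" and le x assume dir: "directed_set D le" and x: "x \<in> D \<rightarrow> X"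
  have "(INF x\<in>X. ereal (f x y)) \<le> Limsup (tail_filter D le) (\<lambda>\<alpha>. ereal (f (x \<alpha>) y))" for y
    unfolding Limsup_tail_filter[OF dir]
  proof (rule INF_greatest)
    fix i assume "i \<in> D"
    then show "(INF x\<in>X. ereal (f x y)) \<le> (SUP j\<in>{j\<in>D. le i j}. ereal (f (x j) y))"
      using x directed_setD(2)[OF dir]
      by (intro order_trans[OF INF_lower[of "x i"] SUP_upper[of i]]) auto
  qed
  then have "(SUP y\<in>Y. INF x\<in>X. ereal (f x y)) \<le>
      (SUP y\<in>Y. Limsup (tail_filter D le) (\<lambda>\<alpha>. ereal (f (x \<alpha>) y)))"
    by (intro SUP_mono) blast
  then show "(INF x\<in>X. SUP y\<in>Y. ereal (f x y)) \<le>
      (SUP y\<in>Y. Limsup (tail_filter D le) (\<lambda>\<alpha>. ereal (f (x \<alpha>) y)))"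
    using assms unfolding minimax_equality_def by simp
qed

lemma minimax_equality_if_net_condition:
  fixes X :: "'a set" and Y :: "'b set"
  assumes "X \<noteq> {}" and t: "0 < t" "t < 1" and "convexlike_on t X Y f"
    and "supinf_concave_on X Y f"
    and net: "net_condition TYPE('b set \<times> real) X Y f"
  shows "minimax_equality X Y f"
proof -
  define v where "v = (SUP y\<in>Y. INF x\<in>X. ereal (f x y))"
  have "(INF x\<in>X. SUP y\<in>Y. ereal (f x y)) \<le> v"
  proof (cases "v = \<infinity>")
    case False
    define D where "D = {(F, c). finite F \<and> F \<subseteq> Y \<and> v < ereal c}"
    \<comment> \<open>Later indices control more functions with a bound closer to \<open>v\<close>.
      Real bounds \<open>c\<close> also serve the case that \<open>v\<close> is minus
      infinity.\<close>
    define le where "le = (\<lambda>(F :: 'b set, c :: real) (G, d). F \<subseteq> G \<and> d \<le> c)"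
    obtain c0 where c0: "v < ereal c0" using ereal_dense2[of v \<infinity>] False by auto
    have dir: "directed_set D le"
      unfolding directed_set_def
    proof (intro conjI ballI)
      have "({}, c0) \<in> D" using c0 by (simp add: D_def)
      then show "D \<noteq> {}" by blast
      show "reflp_on D le" "transp_on D le"
        by (auto simp: reflp_on_def transp_on_def le_def)
      fix i j assume "i \<in> D" "j \<in> D"
      then show "\<exists>k\<in>D. le i k \<and> le j k"
        by (intro bexI[of _ "(fst i \<union> fst j, min (snd i) (snd j))"])
           (auto simp: D_def le_def min_def)
    qed
    have "\<forall>i\<in>D. \<exists>x\<in>X. \<forall>y\<in>fst i. f x y < snd i"
      using ex_below_on_finite[OF assms(1-5)] unfolding D_def v_def by auto
    then obtain x where x: "\<And>i. i \<in> D \<Longrightarrow> x i \<in> X"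
        "\<And>i y. i \<in> D \<Longrightarrow> y \<in> fst i \<Longrightarrow> f (x i) y < snd i"
      by metis
    have "Limsup (tail_filter D le) (\<lambda>\<alpha>. ereal (f (x \<alpha>) y)) \<le> v" if "y \<in> Y" for y
    proof (rule dense_ge)
      fix u assume "v < u"
      then obtain c where c: "v < ereal c" "ereal c < u" using ereal_dense2 by blast
      \<comment> \<open>From this index on, \<open>y\<close> belongs to the finite set and the bound
        is at most \<open>c\<close>.\<close>
      have "({y}, c) \<in> D" using c \<open>y \<in> Y\<close> by (simp add: D_def)
      moreover have "f (x j) y \<le> c" if "j \<in> D" "le ({y}, c) j" for j
        using x(2)[OF that(1), of y] that(2) by (auto simp: le_def)
      ultimately have "\<forall>\<^sub>F j in tail_filter D le. ereal (f (x j) y) \<le> ereal c"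
        unfolding eventually_tail_filter[OF dir] by force
      then show "Limsup (tail_filter D le) (\<lambda>\<alpha>. ereal (f (x \<alpha>) y)) \<le> u"
        by (rule order_trans[OF Limsup_bounded less_imp_le[OF c(2)]])
    qed
    then have "(SUP y\<in>Y. Limsup (tail_filter D le) (\<lambda>\<alpha>. ereal (f (x \<alpha>) y))) \<le> v"
      by (rule SUP_least)
    moreover have "x \<in> D \<rightarrow> X" using x(1) by blast
    ultimately show ?thesis
      using net dir unfolding net_condition_def by (meson order_trans)
  qed simp
  \<comment> \<open>Weak duality.\<close>
  moreover have "v \<le> (INF x\<in>X. SUP y\<in>Y. ereal (f x y))"
    unfolding v_def
    by (intro SUP_least INF_greatest) (meson INF_lower SUP_upper order_trans)
  ultimately show ?thesis unfolding minimax_equality_def v_def by (rule antisym)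
qed

text \<open>The canonical index type expresses (a) in the equivalence; the second conjunct gives (a)
  for nets over an arbitrary index type \<open>'i\<close>.\<close>

theorem corollary1:
  fixes X :: "'a set" and Y :: "'b set" and f :: "'a \<Rightarrow> 'b \<Rightarrow> real"
  assumes "X \<noteq> {}" and "Y \<noteq> {}"
    and "\<And>y. y \<in> Y \<Longrightarrow> bounded ((\<lambda>x. f x y) ` X)"
    and "\<exists>t\<in>{0<..<1}. convexlike_on t X Y f"
    and "supinf_concave_on X Y f"
  shows "(net_condition TYPE('a \<times> 'a set) X Y f \<longleftrightarrow> minimax_equality X Y f) \<and>
         (minimax_equality X Y f \<longrightarrow> net_condition TYPE('i) X Y f)"
proof -
  obtain t where "0 < t" "t < 1" "convexlike_on t X Y f" using assms(4) by auto
  \<comment> \<open>\<open>net_condition_any_index\<close> moves the condition to the index type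
    \<open>'b set \<times> real\<close> of the net built from pairs \<open>(F, c)\<close>.\<close>
  then have "minimax_equality X Y f" if "net_condition TYPE('a \<times> 'a set) X Y f"
    using minimax_equality_if_net_condition[OF assms(1) _ _ _ assms(5) net_condition_any_index[OF that]]
    by simp
  then show ?thesis by (auto intro: net_condition_if_minimax_equality)
qed

end
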